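(* Let $X$ be a compact metric space, $f:X\to X$ a homeomorphism and $\phi\in C(X,\mathbb{R})$ a continuous function. Let $H(f,\phi)$ be the set of points at which the additive cocycle $\{\phi_n\}_{n\in\mathbb{Z}}$ induced by $\phi$ has finite peaks. Then there is an $f$-invariant Borel section $\pi:H(f,\phi)\to H(f,\phi)$, i.e. a Borel map with $\pi(fx)=\pi(x)$ and $\pi(x)\in\{f^nx:n\in\mathbb{Z}\}$ for every $x\in H(f,\phi)$. Equivalently, the image of $\pi$ is a fundamental domain of $H(f,\phi)$.
   Context: The additive cocycle induced by $\phi$ over $(X,f)$ is $\phi_n(x)=\phi(x)+\phi(fx)+\cdots+\phi(f^{n-1}x)$ for $n\ge 0$ (so $\phi_0\equiv 0$) and $\phi_n(x)=-\phi(f^{n}x)-\cdots-\phi(f^{-1}x)$ for $n<0$. Put $\Phi_f(x)=\sup_{n\in\mathbb{Z}}\phi_n(x)$. The cocycle has finite peaks at $x\in X$ if the set $\{n\in\mathbb{Z}:\phi_n(x)=\Phi_f(x)\}$ is nonempty and finite; $H(f,\phi)$ denotes the set of all such points. It is an $f$-invariant Borel set. For an $f$-invariant set $E\subset X$, an $f$-invariant Borel section on $E$ is a Borel map $s:E\to E$ with $s\circ f=s$ and $s(x)\in\mathcal{O}(f,x)=\{f^nx:n\in\mathbb{Z}\}$ for all $x\in E$; the image of such a map $s$ is called a fundamental domain of $E$. *)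

theory Defs
  imports "HOL-Analysis.Analysis"
begin

text \<open>The space is a subset \<open>X\<close> of a metric space and \<open>f\<close> a self-map relevant only on \<open>X\<close>;
  negative iterates therefore use the inverse of \<open>f\<close> relative to \<open>X\<close>.\<close>

definition int_iterate :: "'a set \<Rightarrow> ('a \<Rightarrow> 'a) \<Rightarrow> int \<Rightarrow> 'a \<Rightarrow> 'a" where
  "int_iterate X f n = (if 0 \<le> n then f ^^ nat n else inv_into X f ^^ nat (- n))"

definition full_orbit :: "'a set \<Rightarrow> ('a \<Rightarrow> 'a) \<Rightarrow> 'a \<Rightarrow> 'a set" where
  "full_orbit X f x = {int_iterate X f n x | n. True}"

definition additive_cocycle :: "'a set \<Rightarrow> ('a \<Rightarrow> 'a) \<Rightarrow> ('a \<Rightarrow> real) \<Rightarrow> int \<Rightarrow> 'a \<Rightarrow> real" where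
  "additive_cocycle X f \<phi> n x =
     (if 0 \<le> n then (\<Sum>k\<in>{0..<n}. \<phi> (int_iterate X f k x))
      else - (\<Sum>k\<in>{n..<0}. \<phi> (int_iterate X f k x)))"

text \<open>The supremum may be \<open>\<infinity>\<close>, so it is taken in the extended reals
  (on \<^typ>\<open>real\<close> the supremum of an unbounded set is an unspecified value).\<close>

definition cocycle_sup :: "'a set \<Rightarrow> ('a \<Rightarrow> 'a) \<Rightarrow> ('a \<Rightarrow> real) \<Rightarrow> 'a \<Rightarrow> ereal" where
  "cocycle_sup X f \<phi> x = (SUP n. ereal (additive_cocycle X f \<phi> n x))"

definition finite_peaks_at :: "'a set \<Rightarrow> ('a \<Rightarrow> 'a) \<Rightarrow> ('a \<Rightarrow> real) \<Rightarrow> 'a \<Rightarrow> bool" where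
  "finite_peaks_at X f \<phi> x \<longleftrightarrow>
     (let P = {n. ereal (additive_cocycle X f \<phi> n x) = cocycle_sup X f \<phi> x}
      in P \<noteq> {} \<and> finite P)"

definition finite_peaks_set :: "'a set \<Rightarrow> ('a \<Rightarrow> 'a) \<Rightarrow> ('a \<Rightarrow> real) \<Rightarrow> 'a set" where
  "finite_peaks_set X f \<phi> = {x \<in> X. finite_peaks_at X f \<phi> x}"

text \<open>Measurability between the restricted Borel spaces includes that \<open>s\<close> maps \<open>E\<close> into \<open>E\<close>.\<close>

definition invariant_borel_section ::
    "'a::topological_space set \<Rightarrow> ('a \<Rightarrow> 'a) \<Rightarrow> 'a set \<Rightarrow> ('a \<Rightarrow> 'a) \<Rightarrow> bool" where
  "invariant_borel_section X f E s \<longleftrightarrow>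
     E \<subseteq> X \<and> f ` E = E \<and>
     s \<in> restrict_space borel E \<rightarrow>\<^sub>M restrict_space borel E \<and>
     (\<forall>x\<in>E. s (f x) = s x) \<and>
     (\<forall>x\<in>E. s x \<in> full_orbit X f x)"

definition fundamental_domain ::
    "'a::topological_space set \<Rightarrow> ('a \<Rightarrow> 'a) \<Rightarrow> 'a set \<Rightarrow> 'a set \<Rightarrow> bool" where
  "fundamental_domain X f E D \<longleftrightarrow> (\<exists>s. invariant_borel_section X f E s \<and> D = s ` E)"

end

theory Submission
  imports Defs
begin

text \<open>The set of times at which \<open>\<phi>\<^sub>n(x)\<close> attains its supremum is translated by \<open>-1\<close> when \<open>x\<close> is
  replaced by \<open>f x\<close>. Hence the point of the orbit reached at the last such time depends only on the
  orbit, and choosing it is a Borel operation because the last peak time is an integer-valued Borel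
  function.\<close>

text \<open>Peaks are phrased by comparing real values, without the extended supremum, so that
  membership of \<open>n\<close> is a countable conjunction of inequalities between continuous
  functions.\<close>

definition peak_times :: "'a set \<Rightarrow> ('a \<Rightarrow> 'a) \<Rightarrow> ('a \<Rightarrow> real) \<Rightarrow> 'a \<Rightarrow> int set" where
  "peak_times X f \<phi> x = {n. \<forall>m. additive_cocycle X f \<phi> m x \<le> additive_cocycle X f \<phi> n x}"

definition last_peak :: "'a set \<Rightarrow> ('a \<Rightarrow> 'a) \<Rightarrow> ('a \<Rightarrow> real) \<Rightarrow> 'a \<Rightarrow> 'a" where
  "last_peak X f \<phi> x = int_iterate X f (Max (peak_times X f \<phi> x)) x"

text \<open>A value of the cocycle never exceeds the supremum, so it equals the supremum exactly
  when it bounds all the other values.\<close>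

lemma finite_peaks_at_iff:
  "finite_peaks_at X f \<phi> x \<longleftrightarrow> peak_times X f \<phi> x \<noteq> {} \<and> finite (peak_times X f \<phi> x)"
proof -
  have "ereal (additive_cocycle X f \<phi> n x) = cocycle_sup X f \<phi> x
      \<longleftrightarrow> (\<forall>m. additive_cocycle X f \<phi> m x \<le> additive_cocycle X f \<phi> n x)" for n
  proof -
    have "ereal (additive_cocycle X f \<phi> n x) \<le> cocycle_sup X f \<phi> x"
      unfolding cocycle_sup_def by (rule SUP_upper) simp
    then have "ereal (additive_cocycle X f \<phi> n x) = cocycle_sup X f \<phi> x
      \<longleftrightarrow> cocycle_sup X f \<phi> x \<le> ereal (additive_cocycle X f \<phi> n x)"
      by (metis order.antisym order.refl)
    then show ?thesis
      by (simp add: cocycle_sup_def SUP_le_iff)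
  qed
  then show ?thesis
    by (simp add: finite_peaks_at_def peak_times_def Let_def)
qed

lemma int_iterate_shift:
  assumes "inj_on f X" "x \<in> X"
  shows "int_iterate X f n (f x) = int_iterate X f (n + 1) x"
proof (cases "0 \<le> n")
  case True
  then have "nat (n + 1) = Suc (nat n)" by simp
  then show ?thesis
    using True by (simp add: int_iterate_def funpow_Suc_right del: funpow.simps)
next
  case False
  then have "nat (- n) = Suc (nat (- (n + 1)))" by simp
  then have "int_iterate X f n (f x) = (inv_into X f ^^ nat (- (n + 1))) x"
    using False assms by (simp add: int_iterate_def funpow_Suc_right del: funpow.simps)
  \<comment> \<open>At \<open>n = -1\<close> no inverse step is left, and \<open>n + 1 = 0\<close>
    already belongs to the forward branch of \<open>int_iterate\<close>.\<close>
  then show ?thesis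
    using False by (cases "n = -1") (auto simp: int_iterate_def)
qed

text \<open>This is the cocycle identity at step one. The summand \<open>\<phi> x\<close> does not
  depend on \<open>n\<close>, so passing to \<open>f x\<close> only translates the peak
  times.\<close>

lemma additive_cocycle_shift:
  assumes "inj_on f X" "x \<in> X"
  shows "additive_cocycle X f \<phi> (n + 1) x = \<phi> x + additive_cocycle X f \<phi> n (f x)"
proof -
  let ?a = "\<lambda>k. \<phi> (int_iterate X f k x)"
  have a0: "?a 0 = \<phi> x" by (simp add: int_iterate_def)
  have shift: "(\<Sum>k\<in>{i..<j}. \<phi> (int_iterate X f k (f x))) = (\<Sum>k\<in>{i + 1..<j + 1}. ?a k)" for i j
    by (rule sum.reindex_bij_witness[where i = "\<lambda>k. k - 1" and j = "\<lambda>k. k + 1"])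
       (auto simp: int_iterate_shift[OF assms])
  show ?thesis
  proof (cases "0 \<le> n")
    case True
    then have "{0..<n + 1} = insert 0 {0 + 1..<n + 1}" by auto
    then have "(\<Sum>k\<in>{0..<n + 1}. ?a k) = \<phi> x + (\<Sum>k\<in>{0 + 1..<n + 1}. ?a k)"
      by (simp add: a0)
    then show ?thesis
      using True shift[of 0 n] by (simp add: additive_cocycle_def)
  next
    case False
    \<comment> \<open>For negative \<open>n\<close> the reindexed sum runs up to index 0, one more
      than the sum for \<open>x\<close>; the extra term is \<open>\<phi> x\<close>. At
      \<open>n = -1\<close> the sum for \<open>x\<close> is empty.\<close>
    then have "{n + 1..<0 + 1} = insert 0 {n + 1..<0}" by auto
    then have "(\<Sum>k\<in>{n + 1..<0 + 1}. ?a k) = \<phi> x + (\<Sum>k\<in>{n + 1..<0}. ?a k)"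
      by (simp add: a0)
    then show ?thesis
      using False shift[of n 0] by (cases "n = -1") (auto simp: additive_cocycle_def)
  qed
qed

lemma peak_times_shift:
  assumes "inj_on f X" "x \<in> X"
  shows "peak_times X f \<phi> x = (\<lambda>n. n + 1) ` peak_times X f \<phi> (f x)"
proof -
  have "n + 1 \<in> peak_times X f \<phi> x \<longleftrightarrow> n \<in> peak_times X f \<phi> (f x)" for n
  proof -
    have "n + 1 \<in> peak_times X f \<phi> x \<longleftrightarrow>
        (\<forall>m. additive_cocycle X f \<phi> (m + 1) x \<le> additive_cocycle X f \<phi> (n + 1) x)"
      \<comment> \<open>Every integer is of the form \<open>m + 1\<close>, so the quantifier may
        range over shifted times.\<close>
      unfolding peak_times_def mem_Collect_eq by (metis diff_add_cancel)
    then show ?thesis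
      by (simp add: additive_cocycle_shift[OF assms] peak_times_def)
  qed
  then have "peak_times X f \<phi> (f x) = (\<lambda>n. n - 1) ` peak_times X f \<phi> x"
    by (smt (verit) image_iff set_eqI)
  then show ?thesis
    by (simp add: image_image)
qed

lemma finite_peaks_set_shift:
  assumes "bij_betw f X X" "x \<in> X"
  shows "f x \<in> finite_peaks_set X f \<phi> \<longleftrightarrow> x \<in> finite_peaks_set X f \<phi>"
proof -
  have "finite (peak_times X f \<phi> x) \<longleftrightarrow> finite (peak_times X f \<phi> (f x))"
    unfolding peak_times_shift[OF bij_betw_imp_inj_on[OF assms(1)] assms(2)]
    by (simp add: finite_image_iff)
  then show ?thesis
    using assms peak_times_shift[OF bij_betw_imp_inj_on[OF assms(1)] assms(2), of \<phi>]
    by (auto simp: finite_peaks_set_def finite_peaks_at_iff bij_betw_apply)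
qed

lemma finite_peaks_set_image:
  assumes "bij_betw f X X"
  shows "f ` finite_peaks_set X f \<phi> = finite_peaks_set X f \<phi>"
proof -
  \<comment> \<open>Surjectivity provides a preimage in \<open>X\<close>, which the shift
    equivalence then places in the set.\<close>
  have "finite_peaks_set X f \<phi> \<subseteq> f ` X"
    using assms by (auto simp: finite_peaks_set_def bij_betw_def)
  moreover have "finite_peaks_set X f \<phi> \<subseteq> X"
    by (auto simp: finite_peaks_set_def)
  ultimately show ?thesis
    using finite_peaks_set_shift[OF assms] by blast
qed

text \<open>The inverse is taken relative to \<open>X\<close>, not \<open>E\<close>; injectivity on
  all of \<open>X\<close> forces it to return the preimage lying in \<open>E\<close>. The lemma
  serves both for \<open>X\<close> itself and for the set of finite peaks.\<close>

lemma int_iterate_in: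
  assumes "inj_on f X" "E \<subseteq> X" "f ` E = E" "x \<in> E"
  shows "int_iterate X f n x \<in> E"
proof -
  have "inv_into X f y \<in> E" if "y \<in> E" for y
  proof -
    have "y \<in> f ` E" using that assms(3) by simp
    then obtain z where "z \<in> E" "y = f z" by (rule imageE)
    then show ?thesis using assms(1,2) by (simp add: subset_iff)
  qed
  then have "(inv_into X f ^^ k) x \<in> E" for k
    using assms(4) by (induction k) auto
  moreover have "(f ^^ k) x \<in> E" for k
    using assms(3,4) by (induction k) auto
  ultimately show ?thesis by (simp add: int_iterate_def)
qed

lemma continuous_on_funpow:
  assumes "continuous_on X h" "h ` X \<subseteq> X"
  shows "continuous_on X (h ^^ k)"
proof (induction k)
  case (Suc k)
  have "(h ^^ k) x \<in> X" if "x \<in> X" for x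
    using that assms(2) by (induction k) auto
  then show ?case
    using continuous_on_compose2[OF assms(1) Suc] by auto
qed simp

lemma homeomorphism_imp_bij_betw: "homeomorphism X Y f g \<Longrightarrow> bij_betw f X Y"
  by (metis bij_betw_def homeomorphism_def inj_on_inverseI)

lemma continuous_on_int_iterate:
  assumes "homeomorphism X X f g"
  shows "continuous_on X (int_iterate X f n)"
proof -
  have bij: "bij_betw f X X"
    using assms by (rule homeomorphism_imp_bij_betw)
  \<comment> \<open>Continuity of negative iterates comes from \<open>g\<close>, with which the
    chosen inverse agrees on \<open>X\<close>.\<close>
  have g: "inv_into X f y = g y" if "y \<in> X" for y
    using assms bij that
    by (metis bij_betw_def homeomorphism_def imageI inv_into_f_f)
  have "continuous_on X (inv_into X f)" "inv_into X f ` X \<subseteq> X"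
    using assms g by (auto simp: homeomorphism_def cong: continuous_on_cong)
  moreover have "continuous_on X f" "f ` X \<subseteq> X"
    using assms by (auto simp: homeomorphism_def)
  ultimately show ?thesis
    by (simp add: int_iterate_def continuous_on_funpow)
qed

lemma continuous_on_additive_cocycle:
  assumes "homeomorphism X X f g" "continuous_on X \<phi>"
  shows "continuous_on X (additive_cocycle X f \<phi> n)"
proof -
  have "f ` X = X" using assms(1) by (simp add: homeomorphism_def)
  then have "continuous_on X (\<lambda>x. \<phi> (int_iterate X f k x))" for k
    using int_iterate_in[OF bij_betw_imp_inj_on[OF homeomorphism_imp_bij_betw[OF assms(1)]], of X]
    by (auto intro: continuous_on_compose2[OF assms(2) continuous_on_int_iterate[OF assms(1)]])
  then show ?thesis
    unfolding additive_cocycle_def by (cases "0 \<le> n") (auto intro!: continuous_intros)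
qed

lemma measurable_Max_int_set:
  fixes P :: "'a \<Rightarrow> int set"
  assumes [measurable]: "\<And>n. Measurable.pred M (\<lambda>x. n \<in> P x)"
    and P: "\<And>x. x \<in> space M \<Longrightarrow> finite (P x) \<and> P x \<noteq> {}"
  shows "(\<lambda>x. Max (P x)) \<in> M \<rightarrow>\<^sub>M count_space UNIV"
proof -
  have "{x \<in> space M. Max (P x) = n} \<in> sets M" for n
  proof -
    \<comment> \<open>Finiteness and nonemptiness make \<open>Max\<close> a genuine maximum; the
      remaining quantifier is over the countable type of integers.\<close>
    have "{x \<in> space M. Max (P x) = n} = {x \<in> space M. n \<in> P x \<and> (\<forall>m. m \<in> P x \<longrightarrow> m \<le> n)}"
      using P by (auto simp: Max_eq_iff)
    also have "\<dots> \<in> sets M" by measurable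
    finally show ?thesis .
  qed
  then show ?thesis
    by (auto simp: measurable_count_space_eq2_countable vimage_def Int_def conj_commute)
qed

text \<open>The set of finite peaks splits into countably many measurable pieces by the last peak
  time, and on each piece the map is one fixed continuous iterate.\<close>

lemma measurable_last_peak:
  fixes X :: "'a::metric_space set"
  assumes "homeomorphism X X f g" "continuous_on X \<phi>"
  defines "M \<equiv> restrict_space borel (finite_peaks_set X f \<phi>)"
  shows "last_peak X f \<phi> \<in> M \<rightarrow>\<^sub>M M"
proof -
  let ?H = "finite_peaks_set X f \<phi>"
  have bij: "bij_betw f X X"
    using assms(1) by (rule homeomorphism_imp_bij_betw)
  have HX: "?H \<subseteq> X" by (auto simp: finite_peaks_set_def)
  have [measurable]: "additive_cocycle X f \<phi> n \<in> borel_measurable M" for n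
    unfolding M_def
    by (intro borel_measurable_continuous_on_restrict
        continuous_on_subset[OF continuous_on_additive_cocycle[OF assms(1,2)] HX])
  have "Measurable.pred M (\<lambda>x. n \<in> peak_times X f \<phi> x)" for n
    unfolding peak_times_def mem_Collect_eq by measurable
  then have "(\<lambda>x. Max (peak_times X f \<phi> x)) \<in> M \<rightarrow>\<^sub>M count_space UNIV"
    by (rule measurable_Max_int_set)
       (simp add: M_def space_restrict_space finite_peaks_set_def finite_peaks_at_iff)
  \<comment> \<open>Invariance of the set of finite peaks is what allows \<open>M\<close> as the
    target space.\<close>
  moreover have "int_iterate X f n \<in> M \<rightarrow>\<^sub>M M" for n
    unfolding M_def
    using int_iterate_in[OF bij_betw_imp_inj_on[OF bij] HX finite_peaks_set_image[OF bij]]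
    by (intro measurable_restrict_space2 borel_measurable_continuous_on_restrict
        continuous_on_subset[OF continuous_on_int_iterate[OF assms(1)] HX])
       (auto simp: space_restrict_space)
  ultimately show ?thesis
    unfolding last_peak_def by (rule measurable_compose_countable[rotated])
qed

lemma last_peak_invariant:
  assumes "bij_betw f X X" "x \<in> finite_peaks_set X f \<phi>"
  shows "last_peak X f \<phi> (f x) = last_peak X f \<phi> x"
proof -
  have x: "inj_on f X" "x \<in> X"
    using assms by (auto simp: finite_peaks_set_def bij_betw_def)
  have "f x \<in> finite_peaks_set X f \<phi>"
    using finite_peaks_set_shift[OF assms(1) x(2)] assms(2) by simp
  \<comment> \<open>The translation by 1 is monotone, so it commutes with \<open>Max\<close> on a
    finite nonempty set. The time lost by starting at \<open>f x\<close> is thus exactly the step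
    already made.\<close>
  then have "Max (peak_times X f \<phi> x) = Max (peak_times X f \<phi> (f x)) + 1"
    unfolding peak_times_shift[OF x]
    by (intro mono_Max_commute[symmetric])
       (auto simp: mono_def finite_peaks_set_def finite_peaks_at_iff)
  then show ?thesis
    by (simp add: last_peak_def int_iterate_shift[OF x])
qed

theorem theoremA:
  fixes X :: "'a::metric_space set" and f g :: "'a \<Rightarrow> 'a" and \<phi> :: "'a \<Rightarrow> real"
  assumes "compact X"
    and "homeomorphism X X f g"
    and "continuous_on X \<phi>"
  shows "\<exists>\<pi>. invariant_borel_section X f (finite_peaks_set X f \<phi>) \<pi> \<and>
             fundamental_domain X f (finite_peaks_set X f \<phi>) (\<pi> ` finite_peaks_set X f \<phi>)"
proof -
  have bij: "bij_betw f X X"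
    using assms(2) by (rule homeomorphism_imp_bij_betw)
  have "invariant_borel_section X f (finite_peaks_set X f \<phi>) (last_peak X f \<phi>)"
    unfolding invariant_borel_section_def
    using measurable_last_peak[OF assms(2,3)] finite_peaks_set_image[OF bij]
      last_peak_invariant[OF bij]
    by (auto simp: finite_peaks_set_def full_orbit_def last_peak_def)
  then show ?thesis
    unfolding fundamental_domain_def by blast
qed

end
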